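(* Every sink-free split digraph $D$ admits a quasi-kernel of size at most $\frac{2}{3}|V(D)|$.
   Context: Digraphs are finite and loopless; at most one arc $(u,v)$ exists for each ordered pair of distinct vertices, but both arcs $(u,v)$ and $(v,u)$ may be present. A sink is a vertex with no outneighbor; a digraph is sink-free if it has no sink. A set of vertices is independent if there is no arc between any two of its vertices. A quasi-kernel of a digraph $D$ is an independent set $Q\subseteq V(D)$ such that from every vertex of $D$ there is a directed path of length at most two to some vertex of $Q$ (length zero for vertices of $Q$). A split graph is an undirected graph whose vertex set can be partitioned into a clique and an independent set. A split digraph is a digraph whose underlying undirected graph is a split graph. *)

theory Defs
  imports "Graph_Theory.Graph_Theory"
begin

definition sink :: "('a, 'b) pre_digraph \<Rightarrow> 'a \<Rightarrow> bool" where
  "sink D v \<longleftrightarrow> v \<in> verts D \<and> \<not> (\<exists>w \<in> verts D. v \<rightarrow>\<^bsub>D\<^esub> w)"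

definition sink_free :: "('a, 'b) pre_digraph \<Rightarrow> bool" where
  "sink_free D \<longleftrightarrow> \<not> (\<exists>v. sink D v)"

definition independent_set :: "('a, 'b) pre_digraph \<Rightarrow> 'a set \<Rightarrow> bool" where
  "independent_set D S \<longleftrightarrow> S \<subseteq> verts D \<and> (\<forall>u \<in> S. \<forall>v \<in> S. \<not> u \<rightarrow>\<^bsub>D\<^esub> v)"

text \<open>A path from \<open>u\<close> to \<open>v\<close> is given by its list of arcs, so its length is the length of that
  list; for \<open>p = []\<close> it is the path of length zero at \<open>u = v\<close>.\<close>

definition quasi_kernel :: "('a, 'b) pre_digraph \<Rightarrow> 'a set \<Rightarrow> bool" where
  "quasi_kernel D Q \<longleftrightarrow>
     independent_set D Q \<and>
     (\<forall>u \<in> verts D. \<exists>v \<in> Q. \<exists>p. pre_digraph.apath D u p v \<and> length p \<le> 2)"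

text \<open>Undirected graphs are represented, as in \<^locale>\<open>graph\<close>, by symmetric digraphs.\<close>

definition clique :: "('a, 'b) pre_digraph \<Rightarrow> 'a set \<Rightarrow> bool" where
  "clique G K \<longleftrightarrow> K \<subseteq> verts G \<and> (\<forall>u \<in> K. \<forall>v \<in> K. u \<noteq> v \<longrightarrow> u \<rightarrow>\<^bsub>G\<^esub> v)"

text \<open>Either part of the partition may be empty.\<close>

definition split_graph :: "('a, 'b) pre_digraph \<Rightarrow> bool" where
  "split_graph G \<longleftrightarrow> graph G \<and>
     (\<exists>K I. K \<union> I = verts G \<and> K \<inter> I = {} \<and> clique G K \<and> independent_set G I)"

text \<open>The underlying undirected graph is the symmetric closure \<^const>\<open>mk_symmetric\<close>.\<close>

definition split_digraph :: "('a, 'b) pre_digraph \<Rightarrow> bool" where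
  "split_digraph D \<longleftrightarrow> digraph D \<and> split_graph (with_proj (mk_symmetric D))"

end

theory Submission
  imports Defs
begin

text \<open>Let \<open>K1\<close> be the clique vertices with an outneighbor in the independent part \<open>I\<close>, \<open>K0\<close> the others,
  \<open>I0\<close> the vertices of \<open>I\<close> with all outneighbors in \<open>K0\<close>, \<open>I1 = I - I0\<close>, and \<open>X1\<close> the vertices
  of \<open>K1\<close> with an outneighbor in \<open>I0\<close>, \<open>X2 = K1 - X1\<close>. If every vertex of \<open>K0\<close> has an outneighbor in
  \<open>K1\<close>, then \<open>I0\<close> together with one outneighbor in \<open>I1\<close> for each vertex of \<open>X2\<close> is a quasi-kernel.
  Otherwise some vertices of \<open>K0\<close> are dominated by all of \<open>K1\<close>, and a king \<open>k\<close> among these gives a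
  quasi-kernel inside \<open>{k} \<union> I0\<close>. These sets are small unless \<open>I0\<close> is large. In that case let each
  vertex of \<open>I0\<close> vote for one outneighbor; some king \<open>k\<close> of \<open>K0\<close> has at most half of the votes
  outside its closed inneighborhood, which yields a quasi-kernel containing \<open>k\<close> of size at most
  \<open>1 + |I1| + |I0| / 2 + |X1|\<close>. One of the available sets always has size at most two thirds of all
  vertices.\<close>

section \<open>Kings in weighted semicomplete digraphs\<close>

lemma weighted_king:
  fixes W :: "'a \<Rightarrow> nat"
  assumes "finite K" "K \<noteq> {}"
    and semicomplete: "\<And>u v. u \<in> K \<Longrightarrow> v \<in> K \<Longrightarrow> u \<noteq> v \<Longrightarrow> R u v \<or> R v u"
    and pos: "\<And>v. v \<in> K \<Longrightarrow> 0 < W v"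
  shows "\<exists>k\<in>K. 2 * sum W {v \<in> K. v \<noteq> k \<and> \<not> R v k} \<le> sum W K \<and>
    (\<forall>v\<in>K. v = k \<or> R v k \<or> (\<exists>z\<in>K. R v z \<and> R z k))"
proof -
  define S where "S k = {v \<in> K. v \<noteq> k \<and> \<not> R v k}" for k
  \<comment> \<open>Minimality of this weight yields both conclusions: the halving by averaging, and
    the king property because a vertex violating it would have a lighter set.\<close>
  define k where "k = arg_min_on (\<lambda>k. sum W (S k)) K"
  have k: "k \<in> K" and min: "sum W (S k) \<le> sum W (S v)" if "v \<in> K" for v
    unfolding k_def using assms(1,2) that
    by (auto intro: arg_min_if_finite(1) arg_min_least)
  have fS: "finite (S v)" for v
    using assms(1) by (simp add: S_def)
  have half: "2 * sum W (S k) \<le> sum W K"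
  proof -
    define f where "f u v = (if v \<in> S u then W u * W v else 0)" for u v
    have fsum: "W u * sum W (S u) = (\<Sum>v\<in>K. f u v)" if "u \<in> K" for u
    proof -
      have "S u = K \<inter> {v. v \<in> S u}" by (auto simp: S_def)
      then have "sum W (S u) = (\<Sum>v\<in>K. if v \<in> S u then W v else 0)"
        by (simp add: sum.If_cases[OF assms(1)])
      then show ?thesis
        by (simp add: f_def sum_distrib_left if_distrib cong: if_cong)
    qed
    \<comment> \<open>The minimum of \<open>sum W (S u)\<close> is at most its average with respect
      to the weights \<open>W\<close>.\<close>
    have "2 * (sum W K * sum W (S k)) \<le> 2 * (\<Sum>u\<in>K. W u * sum W (S u))"
      using min by (auto simp: sum_distrib_right intro!: sum_mono)
    also have "\<dots> = (\<Sum>u\<in>K. \<Sum>v\<in>K. f u v) + (\<Sum>u\<in>K. \<Sum>v\<in>K. f v u)"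
      using sum.swap[of f K K] by (simp add: fsum)
    also have "\<dots> = (\<Sum>u\<in>K. \<Sum>v\<in>K. f u v + f v u)"
      by (simp add: sum.distrib)
    \<comment> \<open>By semicompleteness, \<open>v\<close> in \<open>S u\<close> and
      \<open>u\<close> in \<open>S v\<close> exclude each other, so at most one of the two summands
      is nonzero.\<close>
    also have "\<dots> \<le> (\<Sum>u\<in>K. \<Sum>v\<in>K. W u * W v)"
      using semicomplete by (intro sum_mono) (auto simp: f_def S_def)
    also have "\<dots> = sum W K * sum W K"
      by (simp add: sum_product)
    finally have "sum W K * (2 * sum W (S k)) \<le> sum W K * sum W K"
      by (simp add: ac_simps)
    moreover have "0 < sum W K"
      using assms(1,2) pos by (intro sum_pos) auto
    ultimately show ?thesis by simp
  qed
  have king: "v = k \<or> R v k \<or> (\<exists>z\<in>K. R v z \<and> R z k)" if "v \<in> K" for v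
  proof (rule ccontr)
    assume *: "\<not> ?thesis"
    \<comment> \<open>Every \<open>x\<close> in \<open>S v\<close> is an outneighbor of
      \<open>v\<close>; if \<open>x\<close> were \<open>k\<close> or had an arc to \<open>k\<close>,
      then \<open>v\<close> would reach \<open>k\<close> within two steps.\<close>
    have "S v \<subseteq> S k - {v}"
      using * that semicomplete unfolding S_def by blast
    then have "sum W (S v) \<le> sum W (S k - {v})"
      using fS by (intro sum_mono2) auto
    also have "\<dots> < sum W (S k)"
      using * that fS pos by (intro sum_strict_mono2[where b = v]) (auto simp: S_def)
    finally show False using min[OF that] by simp
  qed
  show ?thesis using half[unfolded S_def] king k assms(2) by blast
qed

section \<open>Split digraphs reduced to their adjacency relation\<close>

locale split_relation =
  fixes R :: "'a \<Rightarrow> 'a \<Rightarrow> bool" and K I :: "'a set"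
  assumes finite_K: "finite K" and finite_I: "finite I" and disjoint: "K \<inter> I = {}"
    and semicomplete: "\<And>u v. u \<in> K \<Longrightarrow> v \<in> K \<Longrightarrow> u \<noteq> v \<Longrightarrow> R u v \<or> R v u"
    and irrefl: "\<And>u. u \<in> K \<Longrightarrow> \<not> R u u"
    and indep: "\<And>u v. u \<in> I \<Longrightarrow> v \<in> I \<Longrightarrow> \<not> R u v"
    and serial: "\<And>u. u \<in> K \<union> I \<Longrightarrow> \<exists>v\<in>K \<union> I. R u v"
begin

text \<open>Walks suffice here in place of paths: without loops, a walk of at most two steps between
  distinct vertices repeats no vertex.\<close>

definition reaches :: "'a \<Rightarrow> 'a set \<Rightarrow> bool" where
  "reaches u Q \<longleftrightarrow> u \<in> Q \<or> (\<exists>v\<in>Q. R u v \<or> (\<exists>z\<in>K \<union> I. R u z \<and> R z v))"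

definition qk :: "'a set \<Rightarrow> bool" where
  "qk Q \<longleftrightarrow> Q \<subseteq> K \<union> I \<and> (\<forall>u\<in>Q. \<forall>v\<in>Q. \<not> R u v) \<and> (\<forall>u\<in>K \<union> I. reaches u Q)"

definition "K1 = {u \<in> K. \<exists>i\<in>I. R u i}"
definition "K0 = K - K1"
definition "I0 = {i \<in> I. \<forall>u\<in>K1. \<not> R i u}"
definition "I1 = I - I0"
definition "X1 = {u \<in> K1. \<exists>i\<in>I0. R u i}"
definition "X2 = K1 - X1"

lemmas part_defs = K1_def K0_def I0_def I1_def X1_def X2_def

lemma finite_parts: "finite K1" "finite K0" "finite I0" "finite I1" "finite X1" "finite X2"
  using finite_K finite_I by (auto simp: part_defs)

lemma I_out: "i \<in> I \<Longrightarrow> \<exists>u\<in>K. R i u"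
  using serial[of i] indep by blast

lemma card_total: "card (K \<union> I) = card X1 + card X2 + card K0 + card I0 + card I1"
proof -
  have "card (K \<union> I) = card K + card I"
    using finite_K finite_I disjoint by (rule card_Un_disjoint)
  moreover have "card K = card K1 + card K0"
    unfolding K0_def using card_mono[OF finite_K, of K1] card_Diff_subset[OF finite_parts(1), of K]
    by (auto simp: K1_def)
  moreover have "card K1 = card X1 + card X2"
    unfolding X2_def using card_mono[OF finite_parts(1), of X1] card_Diff_subset[OF finite_parts(5), of K1]
    by (auto simp: X1_def)
  moreover have "card I = card I0 + card I1"
    unfolding I1_def using card_mono[OF finite_I, of I0] card_Diff_subset[OF finite_parts(3), of I]
    by (auto simp: I0_def)
  ultimately show ?thesis by simp
qed

section \<open>Three constructions of quasi-kernels\<close>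

lemma qk_inside_I:
  assumes dom: "\<And>u. u \<in> K0 \<Longrightarrow> \<exists>v\<in>K1. R u v"
  obtains Q where "qk Q" "card Q \<le> card I0 + card X2" "card Q \<le> card I0 + card I1"
proof -
  have "\<forall>u\<in>X2. \<exists>i\<in>I1. R u i"
    by (auto simp: part_defs)
  then obtain g where g: "\<And>u. u \<in> X2 \<Longrightarrow> g u \<in> I1 \<and> R u (g u)"
    by metis
  define Q where "Q = I0 \<union> g ` X2"
  have QI: "Q \<subseteq> I"
    using g by (auto simp: Q_def I1_def I0_def)
  \<comment> \<open>Since \<open>K1\<close> is absorbed in one step, any other vertex only needs an
    outneighbor in \<open>K1\<close>.\<close>
  have K1Q: "\<exists>v\<in>Q. R u v" if "u \<in> K1" for u
    using that g by (cases "u \<in> X1") (auto simp: Q_def X1_def X2_def)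
  have reach: "reaches u Q" if "u \<in> K \<union> I" for u
  proof (cases "u \<in> Q \<or> u \<in> K1")
    case True
    then show ?thesis using K1Q by (auto simp: reaches_def)
  next
    case False
    then have "\<exists>z\<in>K1. R u z"
      using that dom[of u] by (auto simp: K0_def I0_def Q_def)
    moreover have "K1 \<subseteq> K" by (auto simp: K1_def)
    ultimately show ?thesis
      using K1Q unfolding reaches_def by blast
  qed
  have "qk Q"
    using QI indep reach unfolding qk_def by blast
  moreover have "card Q \<le> card I0 + card X2"
    unfolding Q_def using card_image_le[OF finite_parts(6), of g]
    by (meson card_Un_le add_left_mono order_trans)
  moreover have "card Q \<le> card I0 + card I1"
  proof -
    have "card Q \<le> card (I0 \<union> I1)"
      using g by (intro card_mono) (auto simp: Q_def finite_parts)
    then show ?thesis using card_Un_le[of I0 I1] by linarith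
  qed
  ultimately show thesis by (rule that)
qed

lemma qk_king_above_K1:
  assumes "k0 \<in> K0" "\<And>v. v \<in> K1 \<Longrightarrow> \<not> R k0 v"
  obtains Q where "qk Q" "card Q \<le> 1 + card I0"
proof -
  \<comment> \<open>By semicompleteness, every vertex of \<open>K1\<close> has an arc to every
    vertex of \<open>L\<close>.\<close>
  define L where "L = {u \<in> K0. \<forall>v\<in>K1. \<not> R u v}"
  have L: "finite L" "L \<noteq> {}"
    using assms finite_parts by (auto simp: L_def)
  have L_semicomplete: "R u v \<or> R v u" if "u \<in> L" "v \<in> L" "u \<noteq> v" for u v
    using that semicomplete by (auto simp: L_def K0_def)
  obtain k where k: "k \<in> L"
    and king: "\<And>v. v \<in> L \<Longrightarrow> v = k \<or> R v k \<or> (\<exists>z\<in>L. R v z \<and> R z k)"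
    using weighted_king[of L R "\<lambda>_. 1", OF L L_semicomplete zero_less_one] by blast
  have kK: "k \<in> K" and k_out: "\<And>i. i \<in> I \<Longrightarrow> \<not> R k i"
    using k by (auto simp: L_def K0_def K1_def)
  have K1k: "R v k" if "v \<in> K1" for v
    using that k semicomplete[of v k] by (auto simp: L_def K0_def K1_def)
  \<comment> \<open>These are the vertices of \<open>I\<close> that do not reach \<open>k\<close>
    within two steps. Adding them to \<open>k\<close> keeps independence, since \<open>k\<close> in
    \<open>K0\<close> has no outneighbor in \<open>I\<close>.\<close>
  define J where "J = {i \<in> I. \<not> R i k \<and> (\<forall>u\<in>K. R u k \<longrightarrow> \<not> R i u)}"
  have reach: "reaches u (insert k J)" if u: "u \<in> K \<union> I" for u
  proof -
    consider "u \<in> K1" | "u \<in> L" | "u \<in> K0" "u \<notin> L" | "u \<in> I"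
      using u unfolding K0_def by blast
    then show ?thesis
    proof cases
      case 1
      then show ?thesis using K1k by (auto simp: reaches_def)
    next
      case 2
      then show ?thesis using king[of u] by (auto simp: reaches_def L_def K0_def)
    next
      case 3
      then obtain v where "v \<in> K1" "R u v" by (auto simp: L_def)
      then show ?thesis using K1k by (auto simp: reaches_def K1_def)
    next
      case 4
      then show ?thesis by (auto simp: reaches_def J_def)
    qed
  qed
  \<comment> \<open>A vertex of \<open>I\<close> outside \<open>I0\<close> has an outneighbor in
    \<open>K1\<close>, and that has an arc to \<open>k\<close>.\<close>
  have "J \<subseteq> I0"
    using K1k by (auto simp: J_def I0_def K1_def)
  then have "card J \<le> card I0"
    by (simp add: card_mono finite_parts)
  then have "card (insert k J) \<le> 1 + card I0"
    using \<open>J \<subseteq> I0\<close> finite_parts by (simp add: card_insert_if finite_subset)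
  moreover have "qk (insert k J)"
    using kK k_out irrefl indep reach by (auto simp: qk_def J_def)
  ultimately show thesis by (rule that[rotated])
qed

lemma qk_weighted_king:
  assumes "K0 \<noteq> {}"
  obtains Q where "qk Q" "2 * card Q \<le> 2 + 2 * card I1 + card I0 + 2 * card X1"
proof -
  have "\<forall>i\<in>I0. \<exists>u\<in>K0. R i u"
    using I_out by (fastforce simp: K0_def I0_def)
  then obtain \<phi> where \<phi>: "\<And>i. i \<in> I0 \<Longrightarrow> \<phi> i \<in> K0 \<and> R i (\<phi> i)"
    by metis
  define w where "w v = card {i \<in> I0. \<phi> i = v}" for v
  have w_sum: "sum w A = card {i \<in> I0. \<phi> i \<in> A}" if "finite A" for A
  proof -
    have "{i \<in> I0. \<phi> i \<in> A} = (\<Union>v\<in>A. {i \<in> I0. \<phi> i = v})" by auto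
    then show ?thesis
      using that by (simp add: w_def card_UN_disjoint finite_parts disjoint_iff)
  qed
  \<comment> \<open>The summand 1 makes the weights positive, and the factor is so large that it does not affect
    the halving of \<open>w\<close>.\<close>
  define W where "W v = Suc (card K0) * w v + 1" for v
  have W_sum: "sum W A = Suc (card K0) * sum w A + card A" for A
    unfolding W_def sum.distrib sum_distrib_left by simp
  have W_pos: "0 < W v" for v
    by (simp add: W_def)
  have K0_semicomplete: "R u v \<or> R v u" if "u \<in> K0" "v \<in> K0" "u \<noteq> v" for u v
    using that semicomplete by (auto simp: K0_def)
  obtain k where k: "k \<in> K0"
    and half: "2 * sum W {v \<in> K0. v \<noteq> k \<and> \<not> R v k} \<le> sum W K0"
    and king: "\<And>v. v \<in> K0 \<Longrightarrow> v = k \<or> R v k \<or> (\<exists>z\<in>K0. R v z \<and> R z k)"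
    using weighted_king[of K0 R W, OF finite_parts(2) assms K0_semicomplete W_pos] by blast
  define S where "S = {v \<in> K0. v \<noteq> k \<and> \<not> R v k}"
  have fS: "finite S" by (simp add: S_def finite_parts)
  have w_half: "2 * sum w S \<le> card I0"
  proof (rule ccontr)
    assume "\<not> ?thesis"
    moreover have "sum w K0 = card I0"
      using w_sum[OF finite_parts(2)] \<phi> by (metis (mono_tags, lifting) Collect_cong Collect_mem_eq)
    ultimately have "sum w K0 + 1 \<le> 2 * sum w S" by simp
    \<comment> \<open>An excess of one vote weighs \<open>Suc (card K0)\<close> in \<open>W\<close>,
      more than the \<open>card K0\<close> that the summands 1 add to
      \<open>sum W K0\<close>.\<close>
    then have "Suc (card K0) * (sum w K0 + 1) \<le> Suc (card K0) * (2 * sum w S)"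
      by (rule mult_le_mono2)
    then show False
      using half unfolding W_sum S_def[symmetric] by (simp add: algebra_simps)
  qed
  have kK: "k \<in> K" and k_out: "\<And>i. i \<in> I \<Longrightarrow> \<not> R k i"
    using k by (auto simp: K0_def K1_def)
  \<comment> \<open>A vertex of \<open>K1\<close> outside \<open>U\<close> reaches \<open>k\<close>
    through any of its outneighbors in \<open>I\<close>. One in \<open>U\<close> gets its own
    outneighbor \<open>g u\<close> in \<open>Q\<close>, chosen nonadjacent to
    \<open>k\<close>.\<close>
  define U where "U = {u \<in> K1. \<exists>i\<in>I. R u i \<and> \<not> R i k}"
  have "\<forall>u\<in>U. \<exists>i\<in>I. R u i \<and> \<not> R i k" by (auto simp: U_def)
  then obtain g where g: "\<And>u. u \<in> U \<Longrightarrow> g u \<in> I \<and> R u (g u) \<and> \<not> R (g u) k"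
    by metis
  define J where "J = {i \<in> I. \<not> R i k \<and> (\<forall>u\<in>K. R u k \<or> u \<in> U \<longrightarrow> \<not> R i u)}"
  define Q where "Q = insert k (g ` U \<union> J)"
  have reach: "reaches u Q" if u: "u \<in> K \<union> I" for u
  proof -
    consider "u \<in> U" | "u \<in> K1" "u \<notin> U" | "u \<in> K0" | "u \<in> I"
      using u unfolding K0_def by blast
    then show ?thesis
    proof cases
      case 1
      then show ?thesis using g[of u] by (auto simp: reaches_def Q_def)
    next
      case 2
      then obtain i where "i \<in> I" "R u i" "R i k" by (auto simp: U_def K1_def)
      then show ?thesis by (auto simp: reaches_def Q_def)
    next
      case 3
      then show ?thesis using king[of u] by (auto simp: reaches_def Q_def K0_def)
    next
      case 4
      show ?thesis
      proof (cases "u \<in> J \<or> R u k")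
        case True
        then show ?thesis by (auto simp: reaches_def Q_def)
      next
        case False
        then obtain z where "z \<in> K" "R u z" "R z k \<or> z \<in> U"
          using 4 by (auto simp: J_def)
        then show ?thesis using g[of z] by (auto simp: reaches_def Q_def)
      qed
    qed
  qed
  have "Q \<subseteq> K \<union> I"
    using kK g by (auto simp: Q_def J_def)
  moreover have "\<not> R u v" if "u \<in> Q" "v \<in> Q" for u v
    using that kK k_out irrefl indep g by (auto simp: Q_def J_def)
  ultimately have "qk Q"
    using reach by (auto simp: qk_def)
  moreover have "card Q \<le> 1 + card I1 + card X1 + sum w S"
  proof -
    \<comment> \<open>The vote of a member of \<open>J\<close> in \<open>I0\<close> goes to a vertex
      that is neither \<open>k\<close> nor an inneighbor of \<open>k\<close>, hence lies in
      \<open>S\<close>. If \<open>g u\<close> lies in \<open>I0\<close>, then \<open>u\<close> lies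
      in \<open>X1\<close>.\<close>
    have sub: "Q \<subseteq> {k} \<union> I1 \<union> g ` (U \<inter> X1) \<union> {i \<in> I0. \<phi> i \<in> S}"
    proof
      fix q assume q: "q \<in> Q"
      show "q \<in> {k} \<union> I1 \<union> g ` (U \<inter> X1) \<union> {i \<in> I0. \<phi> i \<in> S}"
      proof (cases "q = k \<or> q \<in> I1")
        case False
        then consider "q \<in> I0" "q \<in> J" | u where "q \<in> I0" "u \<in> U" "q = g u"
          using q g by (auto simp: Q_def I1_def J_def)
        then show ?thesis
        proof cases
          case 1
          then have "\<phi> q \<in> S"
            using \<phi>[of q] by (auto simp: S_def J_def K0_def)
          then show ?thesis using 1 by simp
        next
          case 2
          then have "u \<in> X1" using g[of u] by (auto simp: X1_def U_def)
          then show ?thesis using 2 by blast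
        qed
      qed auto
    qed
    have "card Q \<le> card ({k} \<union> I1 \<union> g ` (U \<inter> X1) \<union> {i \<in> I0. \<phi> i \<in> S})"
      using sub by (intro card_mono) (auto simp: finite_parts)
    also have "\<dots> \<le> card {k} + card I1 + card (g ` (U \<inter> X1)) + card {i \<in> I0. \<phi> i \<in> S}"
      by (meson card_Un_le add_le_mono1 order_trans)
    also have "\<dots> \<le> 1 + card I1 + card X1 + sum w S"
    proof -
      have "card (g ` (U \<inter> X1)) \<le> card (U \<inter> X1)"
        by (intro card_image_le) (simp add: finite_parts)
      also have "\<dots> \<le> card X1"
        by (intro card_mono) (auto simp: finite_parts)
      finally show ?thesis using w_sum[OF fS] by simp
    qed
    finally show ?thesis .
  qed
  ultimately show thesis
    using that w_half by simp
qed

section \<open>Comparison of the size bounds\<close>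

lemma small_qk:
  obtains Q where "qk Q" "3 * card Q \<le> 2 * card (K \<union> I)"
proof (cases "\<forall>u\<in>K0. \<exists>v\<in>K1. R u v")
  case True
  then obtain Q where Q: "qk Q" "card Q \<le> card I0 + card X2" "card Q \<le> card I0 + card I1"
    using qk_inside_I by blast
  show thesis
  proof (cases "K0 = {}")
    case True
    then have "I0 = {}"
      using I_out by (fastforce simp: K0_def I0_def)
    then show thesis
      using that[OF Q(1)] Q(2,3) by (simp add: card_total)
  next
    case False
    then obtain Q' where Q': "qk Q'" "2 * card Q' \<le> 2 + 2 * card I1 + card I0 + 2 * card X1"
      by (rule qk_weighted_king)
    have "card K0 \<ge> 1"
      using False finite_parts by (simp add: Suc_le_eq card_gt_0_iff)
    \<comment> \<open>If the bound on \<open>Q\<close> fails, then |I0| + |X2| > 2 (|X1| + |K0| +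
      |I1|); with |K0| \<ge> 1 this forces the bound on \<open>Q'\<close>.\<close>
    then have "3 * card Q \<le> 2 * card (K \<union> I) \<or> 3 * card Q' \<le> 2 * card (K \<union> I)"
      using Q(2) Q'(2) unfolding card_total by auto
    then show thesis
      using that Q(1) Q'(1) by blast
  qed
next
  case False
  then obtain u where u: "u \<in> K0" "\<And>v. v \<in> K1 \<Longrightarrow> \<not> R u v"
    by blast
  then obtain Q where Q: "qk Q" "card Q \<le> 1 + card I0"
    by (rule qk_king_above_K1)
  obtain Q' where Q': "qk Q'" "2 * card Q' \<le> 2 + 2 * card I1 + card I0 + 2 * card X1"
    using u(1) qk_weighted_king by blast
  \<comment> \<open>The outneighbor of \<open>u\<close> lies neither in \<open>I\<close> nor in
    \<open>K1\<close>, so \<open>K0\<close> has a second vertex, which absorbs the additive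
    constants in the bounds on \<open>Q\<close> and \<open>Q'\<close>.\<close>
  obtain v where "v \<in> K0" "R u v"
    using u serial[of u] by (auto simp: K0_def K1_def)
  then have "card {u, v} \<le> card K0" "u \<noteq> v"
    using u(1) irrefl finite_parts by (auto intro!: card_mono simp: K0_def)
  then have "2 \<le> card K0" by simp
  then have "3 * card Q \<le> 2 * card (K \<union> I) \<or> 3 * card Q' \<le> 2 * card (K \<union> I)"
    using Q(2) Q'(2) unfolding card_total by auto
  then show thesis
    using that Q(1) Q'(1) by blast
qed

end

section \<open>Transfer back to paths in digraphs\<close>

lemma (in wf_digraph) apath_of_dominates:
  assumes "u \<rightarrow>\<^bsub>G\<^esub> v" "u \<noteq> v"
  shows "\<exists>p. apath u p v \<and> length p \<le> 2"
proof -
  from assms(1) obtain e where "e \<in> arcs G" "tail G e = u" "head G e = v"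
    by auto
  then show ?thesis
    using assms by (intro exI[of _ "[e]"]) (auto simp: apath_def awalk_def)
qed

lemma (in wf_digraph) apath_of_dominates2:
  assumes "u \<rightarrow>\<^bsub>G\<^esub> z" "z \<rightarrow>\<^bsub>G\<^esub> v" "u \<noteq> z" "z \<noteq> v" "u \<noteq> v"
  shows "\<exists>p. apath u p v \<and> length p \<le> 2"
proof -
  from assms(1) obtain e where "e \<in> arcs G" "tail G e = u" "head G e = z"
    by auto
  moreover from assms(2) obtain f where "f \<in> arcs G" "tail G f = z" "head G f = v"
    by auto
  ultimately show ?thesis
    using assms by (intro exI[of _ "[e, f]"]) (auto simp: apath_def awalk_def)
qed

theorem theorem1p1:
  fixes D :: "('a, 'b) pre_digraph"
  assumes "split_digraph D" and "sink_free D"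
  shows "\<exists>Q. quasi_kernel D Q \<and> real (card Q) \<le> 2 / 3 * real (card (verts D))"
proof -
  interpret digraph D
    using assms(1) by (simp add: split_digraph_def)
  define R where "R u v = (u \<rightarrow>\<^bsub>D\<^esub> v)" for u v
  have sym: "u \<rightarrow>\<^bsub>with_proj (mk_symmetric D)\<^esub> v \<longleftrightarrow> R u v \<or> R v u" for u v
    by (auto simp: R_def parcs_mk_symmetric intro: in_arcs_imp_in_arcs_ends)
  obtain K I where KI: "K \<union> I = verts D" "K \<inter> I = {}"
    and "clique (with_proj (mk_symmetric D)) K"
    and "independent_set (with_proj (mk_symmetric D)) I"
    using assms(1) by (auto simp: split_digraph_def split_graph_def mk_symmetric_def)
  then have K: "\<And>u v. u \<in> K \<Longrightarrow> v \<in> K \<Longrightarrow> u \<noteq> v \<Longrightarrow> R u v \<or> R v u"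
    and I: "\<And>u v. u \<in> I \<Longrightarrow> v \<in> I \<Longrightarrow> \<not> R u v"
    unfolding clique_def independent_set_def sym by auto
  have loopless: "\<not> R u u" for u
    by (auto simp: R_def dest: adj_not_same)
  have "finite K" "finite I"
    using KI(1) finite_verts by (auto intro: finite_subset)
  moreover have "\<exists>v\<in>K \<union> I. R u v" if "u \<in> K \<union> I" for u
    using that assms(2) KI(1) by (auto simp: sink_free_def sink_def R_def)
  ultimately interpret split_relation R K I
    using KI(2) K I loopless by unfold_locales auto
  obtain Q where Q: "qk Q" "3 * card Q \<le> 2 * card (K \<union> I)"
    by (rule small_qk)
  have "\<exists>v\<in>Q. \<exists>p. apath u p v \<and> length p \<le> 2" if u: "u \<in> verts D" for u
  proof (cases "u \<in> Q")
    case True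
    then show ?thesis
      using u by (intro bexI[of _ u] exI[of _ "[]"]) (auto simp: apath_Nil_iff)
  next
    case False
    have "reaches u Q"
      using Q(1) u KI(1) by (simp add: qk_def)
    with False obtain v where v: "v \<in> Q" "R u v \<or> (\<exists>z. R u z \<and> R z v)"
      unfolding reaches_def by blast
    moreover have "u \<noteq> v" using v(1) False by blast
    ultimately show ?thesis
      using loopless apath_of_dominates[of u v] apath_of_dominates2[of u _ v]
      unfolding R_def by blast
  qed
  then have "quasi_kernel D Q"
    using Q(1) KI(1) by (auto simp: quasi_kernel_def independent_set_def qk_def R_def)
  moreover have "real (card Q) \<le> 2 / 3 * real (card (verts D))"
    using Q(2) KI(1) by simp
  ultimately show ?thesis by blast
qed

end
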